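(* Let $T$ be a minimal rotation on a locally connected compact metrizable group $X$ and let $f\colon X\to G$ be a continuous topologically recurrent cocycle with values in a nilpotent locally compact second countable group $G$. Then $f$ is regular.
   Context: The cocycle is $f(n,x)=f(T^{n-1}x)\cdots f(x)$ for $n\ge1$, $f(0,x)=\mathbf 1_G$, $f(n,x)=f(-n,T^nx)^{-1}$ for $n<0$. $f$ is topologically recurrent if for every open neighbourhood $U$ of $\mathbf 1_G$ and nonempty open $\mathcal O\subseteq X$ there is $n\neq0$ with $T^{-n}\mathcal O\cap\mathcal O\cap\{y:f(n,y)\in U\}\neq\varnothing$. The skew product is $\mathbf T_f(x,g)=(Tx,f(x)g)$ on $X\times G$; $f$ is regular if some point of $X\times G$ has a $\mathbf T_f$-orbit closure that projects onto all of $X$ under the first coordinate projection. *)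

theory Defs
  imports "HOL-Analysis.Analysis" "HOL-Algebra.Generated_Groups"
begin

definition topological_group :: "('a::topological_space) monoid \<Rightarrow> bool" where
  "topological_group G \<longleftrightarrow> group G \<and> carrier G = UNIV \<and>
     continuous_on UNIV (\<lambda>p::'a \<times> 'a. fst p \<otimes>\<^bsub>G\<^esub> snd p) \<and>
     continuous_on UNIV (\<lambda>x. inv\<^bsub>G\<^esub> x)"

fun lower_central :: "('a, 'b) monoid_scheme \<Rightarrow> nat \<Rightarrow> 'a set" where
  "lower_central G 0 = carrier G"
| "lower_central G (Suc k) = generate G
     {x \<otimes>\<^bsub>G\<^esub> y \<otimes>\<^bsub>G\<^esub> inv\<^bsub>G\<^esub> x \<otimes>\<^bsub>G\<^esub> inv\<^bsub>G\<^esub> y | x y. x \<in> lower_central G k \<and> y \<in> carrier G}"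

definition nilpotent_group :: "('a, 'b) monoid_scheme \<Rightarrow> bool" where
  "nilpotent_group G \<longleftrightarrow> group G \<and> (\<exists>k. lower_central G k = {one G})"

definition iter_int :: "('a \<Rightarrow> 'a) \<Rightarrow> int \<Rightarrow> 'a \<Rightarrow> 'a" where
  "iter_int T n = (if 0 \<le> n then T ^^ nat n else (inv_into UNIV T) ^^ nat (- n))"

definition minimal_homeo :: "('a::topological_space \<Rightarrow> 'a) \<Rightarrow> bool" where
  "minimal_homeo T \<longleftrightarrow> homeomorphism UNIV UNIV T (inv_into UNIV T) \<and>
     (\<forall>x. closure {iter_int T n x | n. True} = UNIV)"

definition rotation :: "'a monoid \<Rightarrow> ('a \<Rightarrow> 'a) \<Rightarrow> bool" where
  "rotation X T \<longleftrightarrow> (\<exists>a \<in> carrier X. \<forall>x \<in> carrier X. T x = a \<otimes>\<^bsub>X\<^esub> x)"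

fun cocycle_nat :: "'g monoid \<Rightarrow> ('x \<Rightarrow> 'g) \<Rightarrow> ('x \<Rightarrow> 'x) \<Rightarrow> nat \<Rightarrow> 'x \<Rightarrow> 'g" where
  "cocycle_nat G f T 0 x = \<one>\<^bsub>G\<^esub>"
| "cocycle_nat G f T (Suc n) x = f ((T ^^ n) x) \<otimes>\<^bsub>G\<^esub> cocycle_nat G f T n x"

definition cocycle :: "'g monoid \<Rightarrow> ('x \<Rightarrow> 'g) \<Rightarrow> ('x \<Rightarrow> 'x) \<Rightarrow> int \<Rightarrow> 'x \<Rightarrow> 'g" where
  "cocycle G f T n x = (if 0 \<le> n then cocycle_nat G f T (nat n) x
      else inv\<^bsub>G\<^esub> (cocycle_nat G f T (nat (- n)) (iter_int T n x)))"

definition topologically_recurrent ::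
    "('g::topological_space) monoid \<Rightarrow> ('x::topological_space \<Rightarrow> 'g) \<Rightarrow> ('x \<Rightarrow> 'x) \<Rightarrow> bool" where
  "topologically_recurrent G f T \<longleftrightarrow>
     (\<forall>U V. open U \<and> \<one>\<^bsub>G\<^esub> \<in> U \<and> open V \<and> V \<noteq> {} \<longrightarrow>
        (\<exists>n::int. n \<noteq> 0 \<and> (\<exists>y. y \<in> V \<and> iter_int T n y \<in> V \<and> cocycle G f T n y \<in> U)))"

definition skew_product :: "'g monoid \<Rightarrow> ('x \<Rightarrow> 'g) \<Rightarrow> ('x \<Rightarrow> 'x) \<Rightarrow> 'x \<times> 'g \<Rightarrow> 'x \<times> 'g" where
  "skew_product G f T = (\<lambda>(x, g). (T x, f x \<otimes>\<^bsub>G\<^esub> g))"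

definition regular_cocycle ::
    "('g::topological_space) monoid \<Rightarrow> ('x::topological_space \<Rightarrow> 'g) \<Rightarrow> ('x \<Rightarrow> 'x) \<Rightarrow> bool" where
  "regular_cocycle G f T \<longleftrightarrow>
     (\<exists>p. fst ` closure {iter_int (skew_product G f T) n p | n. True} = UNIV)"

end

theory Submission
  imports Defs
begin

text \<open>Let \<open>A i\<close> be the lower central series of \<open>G\<close> and fix a Baire generic point \<open>x0\<close>. Let \<open>M i\<close>
  be the orbit closure of \<open>(x0, 1)\<close> in \<open>X \<times> G\<close> modulo \<open>A i\<close>, and \<open>E i\<close> its fibre over \<open>x0\<close>.
  By genericity \<open>E i\<close> consists of all essential values at \<open>x0\<close> modulo \<open>A i\<close>, so it is a closed
  group; these groups decrease from \<open>G\<close>, and since \<open>[A i, G] \<subseteq> A (i + 1)\<close>, the group \<open>E (i + 1)\<close>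
  is normal in \<open>E i\<close>. By induction on \<open>i\<close>, the cocycle stays in \<open>K (E i)\<close> along the orbit of
  \<open>x0\<close> for some compact \<open>K\<close>. In the step, the cocycle modulo a continuous field of conjugates of
  \<open>E (i + 1)\<close> has no nontrivial essential values. Hence on a small connected neighbourhood of
  \<open>x0\<close>, and for times at which the rotation is near the identity, it is either small everywhere
  or large everywhere. By recurrence it is small at nontrivial times, and the argument showing that
  non-discrete monothetic locally compact groups are compact yields boundedness.
  For \<open>A i = 1\<close> boundedness modulo \<open>E i\<close> makes every fibre of the orbit closure nonempty.\<close>

subsection \<open>Topological groups and rotation cocycles\<close>

text \<open>Projecting along a compact factor is a closed map, by the tube lemma. Limits of
  representatives chosen in a compact set are taken through this lemma, without sequences.\<close>

lemma closed_Bex_compact: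
  assumes "compact C" "closed {p. R (fst p) (snd p)}"
  shows "closed {y. \<exists>w\<in>C. R y w}"
proof -
  have "\<exists>U. open U \<and> y \<in> U \<and> U \<subseteq> - {y. \<exists>w\<in>C. R y w}" if y: "y \<in> - {y. \<exists>w\<in>C. R y w}" for y
  proof -
    have "{y} \<times> C \<subseteq> - {p. R (fst p) (snd p)}"
      using y by auto
    from Elementary_Topology.tube_lemma[OF assms(1) _ this] assms(2)
    obtain U where "y \<in> U" "open U" "U \<times> C \<subseteq> - {p. R (fst p) (snd p)}"
      by auto
    then show ?thesis
      by (intro exI[of _ U]) force
  qed
  then have "open (- {y. \<exists>w\<in>C. R y w})"
    by (rule Topological_Spaces.openI) blast
  then show ?thesis
    by (simp add: closed_def)
qed

lemma closure_map:
  assumes "continuous_on UNIV h" "h ` S \<subseteq> closure S'" "p \<in> closure S"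
  shows "h p \<in> closure S'"
  using image_closure_subset[OF continuous_on_subset[OF assms(1)], of S "closure S'"] assms
  by auto

lemma closed_Collect_mem:
  assumes "closed S" "continuous_on UNIV h"
  shows "closed {x. h x \<in> S}"
  using closed_vimage[OF assms] by (simp add: vimage_def)

lemma open_Collect_mem:
  assumes "open S" "continuous_on UNIV h"
  shows "open {x. h x \<in> S}"
  using open_vimage[OF assms] by (simp add: vimage_def)

locale topgroup = group G for G :: "('a::topological_space) monoid" (structure) +
  assumes carrier_UNIV [simp]: "carrier G = UNIV"
    and continuous_mult_pair: "continuous_on UNIV (\<lambda>p. fst p \<otimes> snd p)"
    and continuous_inv: "continuous_on UNIV (\<lambda>x. inv x)"
begin

lemma mult_inv_cancel [simp]: "inv x \<otimes> (x \<otimes> y) = y" "x \<otimes> (inv x \<otimes> y) = y"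
  by (simp_all flip: m_assoc)

lemmas group_simps = m_assoc inv_mult_group

lemma continuous_on_mult [continuous_intros]:
  "continuous_on S u \<Longrightarrow> continuous_on S v \<Longrightarrow> continuous_on S (\<lambda>x. u x \<otimes> v x)"
  using continuous_on_compose2[OF continuous_mult_pair continuous_on_Pair, of S u v] by simp

lemma continuous_on_minv [continuous_intros]:
  "continuous_on S u \<Longrightarrow> continuous_on S (\<lambda>x. inv (u x))"
  using continuous_on_compose2[OF continuous_inv, of S u] by simp

lemma open_translate_right: "open U \<Longrightarrow> open {x. x \<otimes> g \<in> U}"
  by (intro open_Collect_mem continuous_intros)

end

lemma topgroup_iff: "topological_group G \<longleftrightarrow> topgroup G"
  by (auto simp: topological_group_def topgroup_def topgroup_axioms_def)

text \<open>Here \<open>\<alpha> n\<close> is the element of \<open>X\<close> by which the n-th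
  iterate of the rotation translates, and \<open>F n\<close> is the n-th cocycle map, for all
  integers n.\<close>

locale rotation_cocycle = X: topgroup X + G: topgroup G
  for X :: "('x::topological_space) monoid" and G :: "('g::topological_space) monoid" (structure) +
  fixes \<alpha> :: "int \<Rightarrow> 'x" and F :: "int \<Rightarrow> 'x \<Rightarrow> 'g"
  assumes rot_add: "\<alpha> (m + n) = \<alpha> m \<otimes>\<^bsub>X\<^esub> \<alpha> n"
    and coc_add: "F (m + n) y = F m (\<alpha> n \<otimes>\<^bsub>X\<^esub> y) \<otimes> F n y"
    and continuous_coc: "continuous_on UNIV (F n)"
    and orbit_dense: "closure (range (\<lambda>n. \<alpha> n \<otimes>\<^bsub>X\<^esub> y)) = UNIV"
    and compact_X: "compact (UNIV :: 'x set)"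
    and locally_connected_X: "open V \<Longrightarrow> y \<in> V \<Longrightarrow> \<exists>U. open U \<and> connected U \<and> y \<in> U \<and> U \<subseteq> V"
    and locally_compact_G: "\<exists>U W. open U \<and> compact W \<and> \<one> \<in> U \<and> U \<subseteq> W"
    and recurrent: "open U \<Longrightarrow> \<one> \<in> U \<Longrightarrow> open V \<Longrightarrow> y \<in> V \<Longrightarrow>
      \<exists>n z. n \<noteq> 0 \<and> z \<in> V \<and> \<alpha> n \<otimes>\<^bsub>X\<^esub> z \<in> V \<and> F n z \<in> U"
begin

lemma rot_0 [simp]: "\<alpha> 0 = \<one>\<^bsub>X\<^esub>"
  using rot_add[of 0 0] X.r_cancel_one by fastforce

lemma rot_minus [simp]: "\<alpha> (- n) = inv\<^bsub>X\<^esub> \<alpha> n"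
  using rot_add[of "- n" n] X.inv_equality[of "\<alpha> (- n)" "\<alpha> n"] by simp

lemma coc_0 [simp]: "F 0 y = \<one>"
  using coc_add[of 0 0 y] G.r_cancel_one by fastforce

lemma coc_minus: "F (- n) (\<alpha> n \<otimes>\<^bsub>X\<^esub> y) = inv F n y"
  using coc_add[of "- n" n y] G.inv_equality[of "F (- n) (\<alpha> n \<otimes>\<^bsub>X\<^esub> y)" "F n y"] by simp

lemma rot_comm: "\<alpha> m \<otimes>\<^bsub>X\<^esub> \<alpha> n = \<alpha> n \<otimes>\<^bsub>X\<^esub> \<alpha> m"
  by (metis rot_add add.commute)

lemma continuous_on_coc [continuous_intros]:
  "continuous_on S u \<Longrightarrow> continuous_on S (\<lambda>x. F n (u x))"
  using continuous_on_compose2[OF continuous_coc, of S u] by simp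

text \<open>Form in which minimality is used: a closed condition that holds along one orbit holds
  everywhere.\<close>

lemma orbit_dense_closed:
  assumes "closed S" "\<And>n. \<alpha> n \<otimes>\<^bsub>X\<^esub> y \<in> S"
  shows "z \<in> S"
  using closure_minimal[of "range (\<lambda>n. \<alpha> n \<otimes>\<^bsub>X\<^esub> y)" S] assms orbit_dense[of y] by auto

text \<open>The skew product orbit of (x, 1) modulo \<open>A\<close>, kept as a subset of X x G. The
  quotient by \<open>A\<close> is never formed, so \<open>A\<close> may fail to be closed.\<close>

definition orb :: "'x \<Rightarrow> 'g set \<Rightarrow> ('x \<times> 'g) set" where
  "orb x A = {(\<alpha> n \<otimes>\<^bsub>X\<^esub> x, F n x \<otimes> s) |n s. s \<in> A}"

text \<open>All transitions, with the displacement \<open>\<alpha> n\<close> in place of the end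
  point. In the closure, the points over displacement 1 carry the essential values at z modulo
  \<open>A\<close>, since z may vary in the limit.\<close>

definition ret :: "'g set \<Rightarrow> ('x \<times> 'x \<times> 'g) set" where
  "ret A = {(z, \<alpha> n, F n z \<otimes> s) |z n s. s \<in> A}"

lemma orbI: "s \<in> A \<Longrightarrow> (\<alpha> n \<otimes>\<^bsub>X\<^esub> x, F n x \<otimes> s) \<in> closure (orb x A)"
  by (rule subsetD[OF closure_subset]) (auto simp: orb_def)

lemma retI: "s \<in> A \<Longrightarrow> (z, \<alpha> n, F n z \<otimes> s) \<in> closure (ret A)"
  by (rule subsetD[OF closure_subset]) (auto simp: ret_def)

text \<open>Reduces a continuous closure property of orbit closures to a check on the orbit itself;
  the analogue for \<open>ret\<close> follows.\<close>

lemma orb_closure_map: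
  assumes "(y, g) \<in> closure (orb x A)" "continuous_on UNIV (\<lambda>p. h (fst p) (snd p))"
    and "\<And>n s. s \<in> A \<Longrightarrow> h (\<alpha> n \<otimes>\<^bsub>X\<^esub> x) (F n x \<otimes> s) \<in> closure T"
  shows "h y g \<in> closure T"
  using closure_map[OF assms(2) _ assms(1), of T] assms(3) by (fastforce simp: orb_def)

lemma ret_closure_map:
  assumes "(z, b, g) \<in> closure (ret A)"
    and "continuous_on UNIV (\<lambda>p. h (fst p) (fst (snd p)) (snd (snd p)))"
    and "\<And>z n s. s \<in> A \<Longrightarrow> h z (\<alpha> n) (F n z \<otimes> s) \<in> closure T"
  shows "h z b g \<in> closure T"
  using closure_map[OF assms(2) _ assms(1), of T] assms(3) by (fastforce simp: ret_def)

end

subsection \<open>Orbit closures of a generic point\<close>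

text \<open>The last assumption says that essential values at \<open>x0\<close>, which are limits
  over varying base points, already arise along the orbit of \<open>x0\<close> alone.\<close>

locale generic_orbit = rotation_cocycle X G \<alpha> F
  for X :: "('x::topological_space) monoid" and G :: "('g::topological_space) monoid" (structure)
    and \<alpha> :: "int \<Rightarrow> 'x" and F :: "int \<Rightarrow> 'x \<Rightarrow> 'g" +
  fixes A :: "nat \<Rightarrow> 'g set" and x0 :: 'x
  assumes A_normal: "A i \<lhd> G"
    and A_commutator: "a \<in> A i \<Longrightarrow> a \<otimes> y \<otimes> inv a \<otimes> inv y \<in> A (Suc i)"
    and A_Suc_subset: "A (Suc i) \<subseteq> A i"
    and A_0: "A 0 = UNIV"
    and generic: "(x0, \<one>\<^bsub>X\<^esub>, g) \<in> closure (ret (A i)) \<Longrightarrow> (x0, g) \<in> closure (orb x0 (A i))"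
begin

abbreviation M :: "nat \<Rightarrow> ('x \<times> 'g) set" where "M i \<equiv> closure (orb x0 (A i))"
abbreviation R :: "nat \<Rightarrow> ('x \<times> 'x \<times> 'g) set" where "R i \<equiv> closure (ret (A i))"
definition E :: "nat \<Rightarrow> 'g set" where "E i = {g. (x0, g) \<in> M i}"

lemma A_one: "\<one> \<in> A i"
  using A_normal[of i] by (simp add: normal_def subgroup.one_closed)

lemma A_mult: "s \<in> A i \<Longrightarrow> t \<in> A i \<Longrightarrow> s \<otimes> t \<in> A i"
  using A_normal[of i] by (simp add: normal_def subgroup.m_closed)

lemma A_inv: "s \<in> A i \<Longrightarrow> inv s \<in> A i"
  using A_normal[of i] by (simp add: normal_def subgroup.m_inv_closed)

lemma A_conj: "s \<in> A i \<Longrightarrow> g \<otimes> s \<otimes> inv g \<in> A i"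
  using normal.inv_op_closed2[OF A_normal[of i], of g s] by simp

lemma A_conj': "s \<in> A i \<Longrightarrow> inv g \<otimes> s \<otimes> g \<in> A i"
  using A_conj[of s i "inv g"] by simp

lemma M_mult_A: "(y, g) \<in> M i \<Longrightarrow> s \<in> A i \<Longrightarrow> (y, g \<otimes> s) \<in> M i"
  by (erule orb_closure_map, intro continuous_intros)
    (simp add: G.m_assoc orbI A_mult)

lemma M_shift: "(y, g) \<in> M i \<Longrightarrow> (\<alpha> n \<otimes>\<^bsub>X\<^esub> y, F n y \<otimes> g) \<in> M i"
  by (erule orb_closure_map, intro continuous_intros X.continuous_on_mult)
    (metis G.m_assoc G.carrier_UNIV UNIV_I X.m_assoc X.carrier_UNIV coc_add orbI rot_add)

lemma R_mult_A: "(z, b, g) \<in> R i \<Longrightarrow> s \<in> A i \<Longrightarrow> (z, b, g \<otimes> s) \<in> R i"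
  by (erule ret_closure_map, intro continuous_intros)
    (simp add: G.m_assoc retI A_mult)

lemma R_shift: "(z, b, g) \<in> R i \<Longrightarrow> (z, \<alpha> n \<otimes>\<^bsub>X\<^esub> b, F n (b \<otimes>\<^bsub>X\<^esub> z) \<otimes> g) \<in> R i"
  by (erule ret_closure_map, intro continuous_intros X.continuous_on_mult)
    (metis G.m_assoc G.carrier_UNIV UNIV_I coc_add retI rot_add)

text \<open>Essential values are transported along an orbit by conjugation, because times m + n and
  n + m agree. The displacement is written as a conjugate, so that only translations
  \<open>\<alpha> m\<close>, \<open>\<alpha> n\<close> have to commute.\<close>

lemma R_conj:
  assumes "(z, b, g) \<in> R i"
  shows "(\<alpha> m \<otimes>\<^bsub>X\<^esub> z, \<alpha> m \<otimes>\<^bsub>X\<^esub> b \<otimes>\<^bsub>X\<^esub> inv\<^bsub>X\<^esub> \<alpha> m, F m (b \<otimes>\<^bsub>X\<^esub> z) \<otimes> g \<otimes> inv F m z) \<in> R i"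
proof (rule ret_closure_map[OF assms], intro continuous_intros X.continuous_on_mult X.continuous_on_minv)
  fix z n s assume "s \<in> A i"
  have "\<alpha> m \<otimes>\<^bsub>X\<^esub> \<alpha> n \<otimes>\<^bsub>X\<^esub> inv\<^bsub>X\<^esub> \<alpha> m = \<alpha> n"
    by (simp add: rot_comm[of m n] X.group_simps)
  moreover have "F m (\<alpha> n \<otimes>\<^bsub>X\<^esub> z) \<otimes> F n z = F n (\<alpha> m \<otimes>\<^bsub>X\<^esub> z) \<otimes> F m z"
    by (metis coc_add add.commute)
  then have "F m (\<alpha> n \<otimes>\<^bsub>X\<^esub> z) \<otimes> (F n z \<otimes> s) \<otimes> inv F m z
      = F n (\<alpha> m \<otimes>\<^bsub>X\<^esub> z) \<otimes> (F m z \<otimes> s \<otimes> inv F m z)"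
    by (simp flip: G.m_assoc)
  ultimately show "(\<alpha> m \<otimes>\<^bsub>X\<^esub> z, \<alpha> m \<otimes>\<^bsub>X\<^esub> \<alpha> n \<otimes>\<^bsub>X\<^esub> inv\<^bsub>X\<^esub> \<alpha> m,
      F m (\<alpha> n \<otimes>\<^bsub>X\<^esub> z) \<otimes> (F n z \<otimes> s) \<otimes> inv F m z) \<in> R i"
    using retI[OF A_conj[OF \<open>s \<in> A i\<close>, of "F m z"], of "\<alpha> m \<otimes>\<^bsub>X\<^esub> z" n] by simp
qed

text \<open>Time reversal: end point and start point exchange roles. Through it \<open>E i\<close>
  becomes closed under inverses.\<close>

lemma R_inv:
  assumes "(z, b, g) \<in> R i"
  shows "(b \<otimes>\<^bsub>X\<^esub> z, inv\<^bsub>X\<^esub> b, inv g) \<in> R i"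
proof (rule ret_closure_map[OF assms], intro continuous_intros X.continuous_on_mult X.continuous_on_minv)
  fix z n s assume "s \<in> A i"
  have "inv (F n z \<otimes> s) = F (- n) (\<alpha> n \<otimes>\<^bsub>X\<^esub> z) \<otimes> (F n z \<otimes> inv s \<otimes> inv F n z)"
    by (simp add: coc_minus G.group_simps)
  then show "(\<alpha> n \<otimes>\<^bsub>X\<^esub> z, inv\<^bsub>X\<^esub> \<alpha> n, inv (F n z \<otimes> s)) \<in> R i"
    using retI[OF A_conj[OF A_inv[OF \<open>s \<in> A i\<close>], of "F n z"], of "\<alpha> n \<otimes>\<^bsub>X\<^esub> z" "- n"] by simp
qed

text \<open>One direction turns end points near \<open>x0\<close> into displacements by dividing by
  \<open>x0\<close>; the other is genericity.\<close>

lemma E_iff_R: "g \<in> E i \<longleftrightarrow> (x0, \<one>\<^bsub>X\<^esub>, g) \<in> R i"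
proof
  assume "g \<in> E i"
  then have "(x0, x0 \<otimes>\<^bsub>X\<^esub> inv\<^bsub>X\<^esub> x0, g) \<in> R i"
    unfolding E_def mem_Collect_eq
    by (rule orb_closure_map[where h = "\<lambda>y g. (x0, y \<otimes>\<^bsub>X\<^esub> inv\<^bsub>X\<^esub> x0, g)"],
        intro continuous_intros X.continuous_on_mult) (simp add: X.group_simps retI)
  then show "(x0, \<one>\<^bsub>X\<^esub>, g) \<in> R i" by simp
qed (simp add: E_def generic)

lemma A_subset_E: "A i \<subseteq> E i"
  using orbI[of _ "A i" 0 x0] by (auto simp: E_def)

text \<open>Right multiplication commutes with the skew product, so an element of the fibre over
  \<open>x0\<close> can be carried along the orbit; normality of \<open>A i\<close> moves s past
  h.\<close>

lemma M_mult_E: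
  assumes "(y, g) \<in> M i" "h \<in> E i"
  shows "(y, g \<otimes> h) \<in> M i"
proof (rule orb_closure_map[OF assms(1)], intro continuous_intros)
  fix n s assume "s \<in> A i"
  have "(\<alpha> n \<otimes>\<^bsub>X\<^esub> x0, F n x0 \<otimes> h) \<in> M i"
    using assms(2) by (simp add: E_def M_shift)
  from M_mult_A[OF this A_conj'[OF \<open>s \<in> A i\<close>, of h]]
  show "(\<alpha> n \<otimes>\<^bsub>X\<^esub> x0, F n x0 \<otimes> s \<otimes> h) \<in> M i"
    by (simp add: G.group_simps)
qed

lemma E_one: "\<one> \<in> E i"
  using A_subset_E A_one by blast

lemma E_mult: "g \<in> E i \<Longrightarrow> h \<in> E i \<Longrightarrow> g \<otimes> h \<in> E i"
  using M_mult_E by (simp add: E_def)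

lemma E_inv: "g \<in> E i \<Longrightarrow> inv g \<in> E i"
  using R_inv[of x0 "\<one>\<^bsub>X\<^esub>" g i] by (simp add: E_iff_R)

lemma closed_E: "closed (E i)"
  unfolding E_def by (intro closed_Collect_mem continuous_intros) auto

lemma M_Suc_subset: "M (Suc i) \<subseteq> M i"
  using A_Suc_subset by (intro closure_mono) (auto simp: orb_def)

lemma E_Suc_subset: "E (Suc i) \<subseteq> E i"
  using M_Suc_subset by (auto simp: E_def)

lemma E_0: "E 0 = UNIV"
  using A_subset_E[of 0] A_0 by blast

text \<open>The elements of \<open>A i\<close> commute with \<open>h\<close> modulo \<open>A (Suc i)\<close>, so the conjugates of \<open>h\<close> along
  the orbit do not see the unbounded \<open>A i\<close>-parts of the cocycle.\<close>

lemma M_conj_R: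
  assumes "(y, g) \<in> M i" "h \<in> E (Suc i)"
  shows "(y, \<one>\<^bsub>X\<^esub>, g \<otimes> h \<otimes> inv g) \<in> R (Suc i)"
proof (rule orb_closure_map[OF assms(1)], intro continuous_intros)
  fix n s assume s: "s \<in> A i"
  have 1: "(\<alpha> n \<otimes>\<^bsub>X\<^esub> x0, \<one>\<^bsub>X\<^esub>, F n x0 \<otimes> h \<otimes> inv F n x0) \<in> R (Suc i)"
    using R_conj[of x0 "\<one>\<^bsub>X\<^esub>" h "Suc i" n] assms(2) by (simp add: E_iff_R)
  have "inv h \<otimes> (s \<otimes> h \<otimes> inv s \<otimes> inv h) \<otimes> h \<in> A (Suc i)"
    by (intro A_conj' A_commutator s)
  from R_mult_A[OF 1 A_conj[OF this, of "F n x0"]]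
  show "(\<alpha> n \<otimes>\<^bsub>X\<^esub> x0, \<one>\<^bsub>X\<^esub>, F n x0 \<otimes> s \<otimes> h \<otimes> inv (F n x0 \<otimes> s)) \<in> R (Suc i)"
    by (simp add: G.group_simps)
qed

lemma E_conj: "g \<in> E i \<Longrightarrow> h \<in> E (Suc i) \<Longrightarrow> g \<otimes> h \<otimes> inv g \<in> E (Suc i)"
  using M_conj_R[of x0 g i h] by (simp add: E_iff_R[of "g \<otimes> h \<otimes> inv g"]) (simp add: E_def)

lemma E_conj': "g \<in> E i \<Longrightarrow> h \<in> E (Suc i) \<Longrightarrow> inv g \<otimes> h \<otimes> g \<in> E (Suc i)"
  using E_conj[OF E_inv, of g i h] by simp

section \<open>Compact representatives modulo \<open>E i\<close> and the fibres of the orbit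
  closures\<close>

definition tight :: "nat \<Rightarrow> 'g set \<Rightarrow> bool" where
  "tight i K \<longleftrightarrow> compact K \<and> (\<forall>n. \<exists>k\<in>K. inv k \<otimes> F n x0 \<in> E i)"

text \<open>Together with \<open>M_mult_E\<close> this says that every nonempty fibre of
  \<open>M i\<close> is a single left coset of \<open>E i\<close>.\<close>

definition distal :: "nat \<Rightarrow> bool" where
  "distal i \<longleftrightarrow> (\<forall>y p q. (y, p) \<in> M i \<longrightarrow> (y, q) \<in> M i \<longrightarrow> inv p \<otimes> q \<in> E i)"

lemma tight_0: "tight 0 {\<one>}"
  by (simp add: tight_def E_0)

lemma distal_0: "distal 0"
  by (simp add: distal_def E_0)

lemma closed_E_translates: "compact K \<Longrightarrow> closed {g. \<exists>k\<in>K. inv k \<otimes> g \<in> E i}"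
  by (rule closed_Bex_compact, assumption, intro closed_Collect_mem closed_E continuous_intros)

text \<open>The product of the compact \<open>K\<close> with the closed group \<open>E i\<close> is
  closed and contains the group coordinates of the orbit, hence those of its closure.\<close>

lemma M_representative:
  assumes "tight i K" "(y, g) \<in> M i"
  obtains k where "k \<in> K" "(y, k) \<in> M i" "inv k \<otimes> g \<in> E i"
proof -
  let ?S = "{g. \<exists>k\<in>K. inv k \<otimes> g \<in> E i}"
  have cl: "closure ?S = ?S"
    using assms(1) closed_E_translates by (simp add: tight_def)
  have "g \<in> closure ?S"
  proof (rule orb_closure_map[OF assms(2)], intro continuous_intros)
    fix n s assume s: "s \<in> A i"
    obtain k where "k \<in> K" "inv k \<otimes> F n x0 \<in> E i"
      using assms(1) by (auto simp: tight_def)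
    with E_mult[of "inv k \<otimes> F n x0" i s] A_subset_E s show "F n x0 \<otimes> s \<in> closure ?S"
      unfolding cl by (auto simp: G.m_assoc)
  qed
  then obtain k where k: "k \<in> K" "inv k \<otimes> g \<in> E i"
    unfolding cl by blast
  have "(y, k) \<in> M i"
    using M_mult_E[OF assms(2) E_inv[OF k(2)]] by (simp add: G.group_simps)
  with k that show thesis by blast
qed

text \<open>The points whose fibre meets \<open>K\<close> form a closed set by compactness, and this
  set contains the dense orbit of \<open>x0\<close>.\<close>

lemma M_fibre:
  assumes "tight i K"
  shows "\<exists>k\<in>K. (y, k) \<in> M i"
proof -
  have "y \<in> {y. \<exists>k\<in>K. (y, k) \<in> M i}"
  proof (rule orbit_dense_closed)
    show "closed {y. \<exists>k\<in>K. (y, k) \<in> M i}"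
      using assms by (intro closed_Bex_compact) (auto simp: tight_def)
    fix n
    have "(\<alpha> n \<otimes>\<^bsub>X\<^esub> x0, F n x0) \<in> M i"
      using orbI[OF A_one, of n x0 i] by simp
    from M_representative[OF assms this]
    show "\<alpha> n \<otimes>\<^bsub>X\<^esub> x0 \<in> {y. \<exists>k\<in>K. (y, k) \<in> M i}" by blast
  qed
  then show ?thesis by simp
qed

text \<open>Two points of one fibre differ by some l in \<open>E i\<close>. Moving the pair along
  the dense orbit towards \<open>x0\<close> preserves l modulo \<open>E (Suc i)\<close>, and over
  \<open>x0\<close> both limits lie in \<open>E (Suc i)\<close>.\<close>

lemma distal_Suc:
  assumes K: "tight (Suc i) K" and dist: "distal i"
  shows "distal (Suc i)"
  unfolding distal_def
proof (intro allI impI)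
  fix y p q assume pq: "(y, p) \<in> M (Suc i)" "(y, q) \<in> M (Suc i)"
  define l where "l = inv p \<otimes> q"
  have l: "l \<in> E i"
    using dist pq M_Suc_subset unfolding distal_def l_def by blast
  \<comment> \<open>A pair of representatives in \<open>K\<close> over z whose quotient is still l
    modulo \<open>E (Suc i)\<close>; a closed condition.\<close>
  let ?R = "\<lambda>z r. (z, fst r) \<in> M (Suc i) \<and> (z, snd r) \<in> M (Suc i)
    \<and> inv (fst r) \<otimes> snd r \<otimes> inv l \<in> E (Suc i)"
  have "x0 \<in> {z. \<exists>r\<in>K\<times>K. ?R z r}"
  proof (rule orbit_dense_closed)
    show "closed {z. \<exists>r\<in>K\<times>K. ?R z r}"
      using K unfolding tight_def
      by (intro closed_Bex_compact compact_Times closed_Collect_conj closed_Collect_mem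
          continuous_intros closed_closure closed_E) auto
    fix m
    obtain k where k: "k \<in> K" "(\<alpha> m \<otimes>\<^bsub>X\<^esub> y, k) \<in> M (Suc i)" "inv k \<otimes> (F m y \<otimes> p) \<in> E (Suc i)"
      using M_representative[OF K M_shift[OF pq(1)]] by metis
    obtain k' where k': "k' \<in> K" "(\<alpha> m \<otimes>\<^bsub>X\<^esub> y, k') \<in> M (Suc i)"
      "inv k' \<otimes> (F m y \<otimes> q) \<in> E (Suc i)"
      using M_representative[OF K M_shift[OF pq(2)]] by metis
    \<comment> \<open>The cocycle factors cancel in the quotient, and l normalises
      \<open>E (Suc i)\<close> because it lies in \<open>E i\<close>.\<close>
    have "(inv k \<otimes> (F m y \<otimes> p)) \<otimes> (l \<otimes> inv (inv k' \<otimes> (F m y \<otimes> q)) \<otimes> inv l) \<in> E (Suc i)"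
      by (intro E_mult k E_conj l E_inv k')
    then have "inv k \<otimes> k' \<otimes> inv l \<in> E (Suc i)"
      by (simp add: l_def G.group_simps)
    with k k' show "\<alpha> m \<otimes>\<^bsub>X\<^esub> y \<in> {z. \<exists>r\<in>K\<times>K. ?R z r}" by force
  qed
  then obtain k k' where k: "k \<in> E (Suc i)" "k' \<in> E (Suc i)" "inv k \<otimes> k' \<otimes> inv l \<in> E (Suc i)"
    by (auto simp: E_def)
  have "inv (inv k' \<otimes> (k \<otimes> (inv k \<otimes> k' \<otimes> inv l))) \<in> E (Suc i)"
    by (rule E_inv[OF E_mult[OF E_inv[OF k(2)] E_mult[OF k(1,3)]]])
  then have "l \<in> E (Suc i)"
    by (simp add: G.group_simps)
  then show "inv p \<otimes> q \<in> E (Suc i)"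
    by (simp add: l_def)
qed

end

subsection \<open>Boundedness modulo essential values\<close>

locale tight_level = generic_orbit X G \<alpha> F A x0
  for X :: "('x::topological_space) monoid" and G :: "('g::topological_space) monoid" (structure)
    and \<alpha> :: "int \<Rightarrow> 'x" and F :: "int \<Rightarrow> 'x \<Rightarrow> 'g" and A :: "nat \<Rightarrow> 'g set" and x0 :: 'x +
  fixes i :: nat and K :: "'g set"
  assumes K: "tight i K" and dist: "distal i"
begin

text \<open>The field of closed groups \<open>H\<close> over y: the conjugate of
  \<open>E (Suc i)\<close> by any g in the fibre of \<open>M i\<close>. It replaces the single group
  \<open>E (Suc i)\<close> at base points other than \<open>x0\<close>.\<close>

definition H :: "('x \<times> 'g) set" where
  "H = {(y, u). \<exists>g. (y, g) \<in> M i \<and> inv g \<otimes> u \<otimes> g \<in> E (Suc i)}"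

lemma compact_K: "compact K"
  using K by (simp add: tight_def)

text \<open>The points whose fibre meets \<open>K\<close> outside V times \<open>E i\<close> form a
  closed set. It misses y, whose whole fibre is the coset of g; off it, a representative in
  \<open>K\<close> can be moved into V by \<open>E i\<close>.\<close>

lemma M_lower_semicontinuous:
  assumes "(y, g) \<in> M i" "open V" "g \<in> V"
  obtains U where "open U" "y \<in> U" "\<And>y'. y' \<in> U \<Longrightarrow> \<exists>g'\<in>V. (y', g') \<in> M i"
proof -
  let ?C = "K - (\<Union>l\<in>E i. {x. x \<otimes> l \<in> V})"
  let ?Z = "{y. \<exists>k\<in>?C. (y, k) \<in> M i}"
  have "open (\<Union>l\<in>E i. {x. x \<otimes> l \<in> V})"
    by (intro open_UN ballI G.open_translate_right assms)
  then have "closed ?Z"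
    using compact_diff[OF compact_K] by (intro closed_Bex_compact) auto
  moreover have "y \<notin> ?Z"
  proof
    assume "y \<in> ?Z"
    then obtain k where "k \<in> ?C" "(y, k) \<in> M i" by blast
    then have "inv k \<otimes> g \<in> E i"
      using dist assms(1) by (simp add: distal_def)
    then show False
      using \<open>k \<in> ?C\<close> \<open>g \<in> V\<close> by auto
  qed
  moreover have "\<exists>g'\<in>V. (y', g') \<in> M i" if "y' \<notin> ?Z" for y'
  proof -
    obtain k where k: "k \<in> K" "(y', k) \<in> M i"
      using M_fibre[OF K] by blast
    with that obtain l where "l \<in> E i" "k \<otimes> l \<in> V" by auto
    then show ?thesis
      using M_mult_E[OF k(2)] by blast
  qed
  ultimately show thesis
    using that[of "- ?Z"] by auto
qed

text \<open>Independence of the choice of g: two choices differ by an element of \<open>E i\<close>,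
  which normalises \<open>E (Suc i)\<close>.\<close>

lemma H_eq:
  assumes "(y, g) \<in> M i"
  shows "(y, u) \<in> H \<longleftrightarrow> inv g \<otimes> u \<otimes> g \<in> E (Suc i)"
proof
  assume "(y, u) \<in> H"
  then obtain g' where g': "(y, g') \<in> M i" "inv g' \<otimes> u \<otimes> g' \<in> E (Suc i)"
    by (auto simp: H_def)
  have "inv g' \<otimes> g \<in> E i"
    using dist assms g' by (simp add: distal_def)
  from E_conj'[OF this g'(2)] show "inv g \<otimes> u \<otimes> g \<in> E (Suc i)"
    by (simp add: G.group_simps)
qed (use assms in \<open>auto simp: H_def\<close>)

lemma H_x0: "(x0, u) \<in> H \<longleftrightarrow> u \<in> E (Suc i)"
  using H_eq[of x0 \<one> u] E_one[of i] by (simp add: E_def)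

lemma H_mult:
  assumes "(y, u) \<in> H" "(y, v) \<in> H"
  shows "(y, u \<otimes> v) \<in> H"
proof -
  obtain g where g: "(y, g) \<in> M i" using M_fibre[OF K] by blast
  show ?thesis
    using E_mult[of "inv g \<otimes> u \<otimes> g" "Suc i" "inv g \<otimes> v \<otimes> g"] assms
    by (simp add: H_eq[OF g] G.group_simps)
qed

lemma H_inv:
  assumes "(y, u) \<in> H"
  shows "(y, inv u) \<in> H"
proof -
  obtain g where g: "(y, g) \<in> M i" using M_fibre[OF K] by blast
  show ?thesis
    using E_inv[of "inv g \<otimes> u \<otimes> g" "Suc i"] assms
    by (simp add: H_eq[OF g] G.group_simps)
qed

lemma H_one: "(y, \<one>) \<in> H"
  using M_fibre[OF K, of y] E_one by (auto simp: H_def)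

lemma closed_H: "closed (H)"
proof -
  have "H = {p. \<exists>k\<in>K. (fst p, k) \<in> M i \<and> inv k \<otimes> snd p \<otimes> k \<in> E (Suc i)}"
    using M_fibre[OF K] H_eq by (fastforce simp: H_def)
  moreover have "closed \<dots>"
    using compact_K
    by (intro closed_Bex_compact closed_Collect_conj closed_Collect_mem
          continuous_intros closed_closure closed_E)
  ultimately show ?thesis by simp
qed

text \<open>Write u as the conjugate of a fixed h in \<open>E (Suc i)\<close> by g, and vary only
  the conjugating element.\<close>

lemma H_lower_semicontinuous:
  assumes "(y, u) \<in> H" "open V" "u \<in> V"
  obtains U where "open U" "y \<in> U" "\<And>y'. y' \<in> U \<Longrightarrow> \<exists>u'\<in>V. (y', u') \<in> H"
proof -
  obtain g where g: "(y, g) \<in> M i" using M_fibre[OF K] by blast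
  define h where "h = inv g \<otimes> u \<otimes> g"
  have h: "h \<in> E (Suc i)" and u: "u = g \<otimes> h \<otimes> inv g"
    using assms(1) H_eq[OF g] by (simp_all add: h_def G.group_simps)
  have "open {g. g \<otimes> h \<otimes> inv g \<in> V}"
    by (intro open_Collect_mem assms continuous_intros)
  then obtain U where U: "open U" "y \<in> U"
    "\<And>y'. y' \<in> U \<Longrightarrow> \<exists>g'\<in>{g. g \<otimes> h \<otimes> inv g \<in> V}. (y', g') \<in> M i"
    using M_lower_semicontinuous[OF g, of "{g. g \<otimes> h \<otimes> inv g \<in> V}"] assms(3) u by auto
  show thesis
  proof (rule that[OF U(1,2)])
    fix y' assume "y' \<in> U"
    then obtain g' where g': "g' \<otimes> h \<otimes> inv g' \<in> V" "(y', g') \<in> M i"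
      using U(3) by blast
    then show "\<exists>u'\<in>V. (y', u') \<in> H"
      using H_eq[OF g'(2)] h by (intro bexI[of _ "g' \<otimes> h \<otimes> inv g'"]) (simp_all add: G.group_simps)
  qed
qed

text \<open>By \<open>M_conj_R\<close> every element of \<open>H\<close> over y is an essential
  value at y; composing with time n gives the claim.\<close>

lemma H_return:
  assumes "(y, u) \<in> H"
  shows "(y, \<alpha> n, F n y \<otimes> u) \<in> R (Suc i)"
proof -
  obtain g where g: "(y, g) \<in> M i" using M_fibre[OF K] by blast
  have "(y, \<one>\<^bsub>X\<^esub>, u) \<in> R (Suc i)"
    using M_conj_R[OF g, of "inv g \<otimes> u \<otimes> g"] assms by (simp add: H_eq[OF g] G.group_simps)
  from R_shift[OF this, of n] show ?thesis by simp
qed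

section \<open>Neighbourhoods multiplied by the field \<open>H\<close>\<close>

definition near :: "'g set \<Rightarrow> ('x \<times> 'g) set" where
  "near U = {(y, w). \<exists>u. (y, u) \<in> H \<and> w \<otimes> inv u \<in> U}"

lemma nearI: "(y, u) \<in> H \<Longrightarrow> w \<otimes> inv u \<in> U \<Longrightarrow> (y, w) \<in> near U"
  by (auto simp: near_def)

lemma near_mult_H:
  assumes "(y, w) \<in> near U" "(y, v) \<in> H"
  shows "(y, w \<otimes> v) \<in> near U"
proof -
  obtain u where u: "(y, u) \<in> H" "w \<otimes> inv u \<in> U"
    using assms by (auto simp: near_def)
  then show ?thesis
    using H_mult[OF u(1) assms(2)] by (intro nearI[of y "u \<otimes> v"]) (simp_all add: G.group_simps)
qed

lemma near_mono: "U \<subseteq> V \<Longrightarrow> near U \<subseteq> near V"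
  by (auto simp: near_def)

lemma open_near:
  assumes "open U"
  shows "open (near U)"
proof (rule Topological_Spaces.openI)
  fix p assume "p \<in> near U"
  then obtain y w u where p: "p = (y, w)" "(y, u) \<in> H" "w \<otimes> inv u \<in> U"
    by (auto simp: near_def)
  have "open {q. fst q \<otimes> inv snd q \<in> U}"
    by (intro open_Collect_mem assms continuous_intros)
  then obtain V1 V2 where V: "open V1" "open V2" "(w, u) \<in> V1 \<times> V2"
    "V1 \<times> V2 \<subseteq> {q. fst q \<otimes> inv snd q \<in> U}"
    using p(3) by (elim open_prod_elim[of _ "(w, u)"]) auto
  obtain Y where Y: "open Y" "y \<in> Y" "\<And>y'. y' \<in> Y \<Longrightarrow> \<exists>u'\<in>V2. (y', u') \<in> H"
    using H_lower_semicontinuous[OF p(2) V(2)] V(3) by auto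
  have "Y \<times> V1 \<subseteq> near U"
    using Y(3) V(4) by (fastforce simp: near_def)
  moreover have "open (Y \<times> V1)" "p \<in> Y \<times> V1"
    using Y V p by (auto intro: open_Times)
  ultimately show "\<exists>T. open T \<and> p \<in> T \<and> T \<subseteq> near U" by blast
qed

lemma closed_near:
  assumes "compact W"
  shows "closed (near W)"
proof -
  have "near W = {p. \<exists>w\<in>W. (fst p, inv w \<otimes> snd p) \<in> H}"
  proof (intro Set.set_eqI iffI)
    fix p assume "p \<in> near W"
    then obtain u where "(fst p, u) \<in> H" "snd p \<otimes> inv u \<in> W"
      by (auto simp: near_def)
    then show "p \<in> {p. \<exists>w\<in>W. (fst p, inv w \<otimes> snd p) \<in> H}"
      by (auto intro!: bexI[of _ "snd p \<otimes> inv u"] simp: G.group_simps)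
  next
    fix p assume "p \<in> {p. \<exists>w\<in>W. (fst p, inv w \<otimes> snd p) \<in> H}"
    then obtain w where "w \<in> W" "(fst p, inv w \<otimes> snd p) \<in> H" by blast
    then show "p \<in> near W"
      using nearI[of "fst p" "inv w \<otimes> snd p" "snd p" W] by (simp add: G.group_simps)
  qed
  moreover have "closed \<dots>"
    by (intro closed_Bex_compact assms closed_Collect_mem closed_H continuous_intros)
  ultimately show ?thesis by simp
qed

text \<open>Modulo \<open>H\<close> only the trivial essential value remains at \<open>x0\<close>.
  Hence, for base points near \<open>x0\<close> and displacements near 1, cocycle values in W modulo
  \<open>H\<close> are already in U modulo \<open>H\<close>.\<close>

lemma near_gap:
  assumes "compact W" "open U" "\<one> \<in> U"
  obtains Y B where "open Y" "x0 \<in> Y" "open B" "\<one>\<^bsub>X\<^esub> \<in> B"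
    "\<And>y n. y \<in> Y \<Longrightarrow> \<alpha> n \<in> B \<Longrightarrow> (y, F n y) \<in> near W \<Longrightarrow> (y, F n y) \<in> near U"
proof -
  \<comment> \<open>Limits of transitions with value in W but not in U modulo \<open>H\<close>.
    Compactness of W makes this set closed; over (\<open>x0\<close>, 1) the limit values lie in
    \<open>E (Suc i)\<close>, which is \<open>H\<close> at \<open>x0\<close>.\<close>
  let ?bad = "{p. \<exists>w\<in>W. (fst p, snd p, w) \<in> R (Suc i) \<and> (fst p, w) \<in> - near U}"
  have "closed ?bad"
    using open_near[OF assms(2)]
    by (intro closed_Bex_compact assms closed_Collect_conj closed_Collect_mem continuous_intros
        closed_closure) (auto simp: closed_def)
  moreover have "(x0, \<one>\<^bsub>X\<^esub>) \<notin> ?bad"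
  proof
    assume "(x0, \<one>\<^bsub>X\<^esub>) \<in> ?bad"
    then obtain w where w: "w \<in> E (Suc i)" "(x0, w) \<notin> near U"
      by (auto simp: E_iff_R)
    then show False
      using nearI[of x0 w w U] assms(3) by (simp add: H_x0)
  qed
  ultimately have "open (- ?bad)" "(x0, \<one>\<^bsub>X\<^esub>) \<in> - ?bad"
    by (auto simp: closed_def)
  then obtain Y B where YB: "open Y" "open B" "(x0, \<one>\<^bsub>X\<^esub>) \<in> Y \<times> B" "Y \<times> B \<subseteq> - ?bad"
    by (rule open_prod_elim)
  show thesis
  proof (rule that[of Y B])
    fix y n assume yn: "y \<in> Y" "\<alpha> n \<in> B" "(y, F n y) \<in> near W"
    then obtain u where u: "(y, u) \<in> H" "F n y \<otimes> inv u \<in> W"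
      by (auto simp: near_def)
    \<comment> \<open>Correcting by u puts the value into W, while \<open>H_return\<close> keeps it
      in the closure of transitions.\<close>
    have "(y, \<alpha> n, F n y \<otimes> inv u) \<in> R (Suc i)"
      by (intro H_return H_inv u)
    moreover have "(y, \<alpha> n) \<notin> ?bad"
      using YB yn by blast
    ultimately have "(y, F n y \<otimes> inv u) \<in> near U"
      using u(2) by auto
    from near_mult_H[OF this u(1)] show "(y, F n y) \<in> near U"
      by (simp add: G.group_simps)
  qed (use YB in auto)
qed

text \<open>By continuity of division at (p, p), quotients of elements of one small D are close to
  the identity.\<close>

lemma uniform_division:
  assumes "open B" "\<one>\<^bsub>X\<^esub> \<in> B" "open U" "\<one> \<in> U"
  obtains D where "open D" "p \<in> D"
    "\<And>b h b' h'. (b, h) \<in> D \<Longrightarrow> (b', h') \<in> D \<Longrightarrow> b \<otimes>\<^bsub>X\<^esub> inv\<^bsub>X\<^esub> b' \<in> B \<and> h \<otimes> inv h' \<in> U"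
proof -
  have "open {r. (fst (fst r) \<otimes>\<^bsub>X\<^esub> inv\<^bsub>X\<^esub> fst (snd r), snd (fst r) \<otimes> inv snd (snd r)) \<in> B \<times> U}"
    by (intro open_Collect_mem open_Times assms continuous_intros X.continuous_on_mult
        X.continuous_on_minv)
  moreover have "(p, p) \<in> \<dots>" using assms by simp
  ultimately obtain D D' where "open D" "open D'" "(p, p) \<in> D \<times> D'" "D \<times> D' \<subseteq>
      {r. (fst (fst r) \<otimes>\<^bsub>X\<^esub> inv\<^bsub>X\<^esub> fst (snd r), snd (fst r) \<otimes> inv snd (snd r)) \<in> B \<times> U}"
    by (rule open_prod_elim)
  then show thesis
    by (intro that[of "D \<inter> D'"]) auto
qed

text \<open>Where the gap holds, being in U and being outside W modulo \<open>H\<close> are open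
  conditions that partition the connected set Y.\<close>

lemma near_dichotomy:
  assumes "open U" "U \<subseteq> W" "compact W" "connected Y"
    and gap: "\<And>y. y \<in> Y \<Longrightarrow> (y, F n y) \<in> near W \<Longrightarrow> (y, F n y) \<in> near U"
    and yz: "y \<in> Y" "z \<in> Y" "(y, F n y) \<in> near W"
  shows "(z, F n z) \<in> near W"
proof (rule ccontr)
  assume z: "(z, F n z) \<notin> near W"
  let ?P = "{y. (y, F n y) \<in> near U}" and ?Q = "{y. (y, F n y) \<in> - near W}"
  have "open ?P" "open ?Q"
    using open_near[OF assms(1)] closed_near[OF assms(3)]
    by (auto intro!: open_Collect_mem continuous_intros simp del: Compl_iff)
  moreover have "?P \<inter> ?Q \<inter> Y = {}" "Y \<subseteq> ?P \<union> ?Q"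
    using near_mono[OF assms(2)] gap by auto
  ultimately have "?P \<inter> Y = {} \<or> ?Q \<inter> Y = {}"
    by (rule connectedD[OF assms(4)])
  then show False
    using z yz gap by auto
qed

text \<open>Times at which the cocycle is small modulo \<open>E (Suc i)\<close> are shown to have
  bounded gaps; finitely many cocycle maps on the compact \<open>X\<close> then bridge the
  gaps.\<close>

lemma tight_Suc: "\<exists>K'. tight (Suc i) K'"
proof -
  obtain U0 W where W: "open U0" "compact W" "\<one> \<in> U0" "U0 \<subseteq> W"
    using locally_compact_G by blast
  obtain Y0 B0 where Y0: "open Y0" "x0 \<in> Y0" and B0: "open B0" "\<one>\<^bsub>X\<^esub> \<in> B0"
    and gap: "\<And>y n. y \<in> Y0 \<Longrightarrow> \<alpha> n \<in> B0 \<Longrightarrow> (y, F n y) \<in> near W \<Longrightarrow> (y, F n y) \<in> near U0"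
    using near_gap[OF W(2,1,3)] by metis
  obtain Y where Y: "open Y" "connected Y" "x0 \<in> Y" "Y \<subseteq> Y0"
    using locally_connected_X[OF Y0] by blast
  have dichotomy: "(z, F n z) \<in> near W"
    if "\<alpha> n \<in> B0" "y \<in> Y" "z \<in> Y" "(y, F n y) \<in> near W" for n y z
    by (rule near_dichotomy[OF W(1,4,2) Y(2)]) (use that gap Y in blast)+
  have near_x0: "(x0, F n x0) \<in> near U \<longleftrightarrow> (\<exists>g\<in>U. inv g \<otimes> F n x0 \<in> E (Suc i))" for n U
  proof
    assume "(x0, F n x0) \<in> near U"
    then obtain u where "u \<in> E (Suc i)" "F n x0 \<otimes> inv u \<in> U"
      by (auto simp: near_def H_x0)
    then show "\<exists>g\<in>U. inv g \<otimes> F n x0 \<in> E (Suc i)"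
      by (intro bexI[of _ "F n x0 \<otimes> inv u"]) (simp_all add: G.group_simps)
  next
    assume "\<exists>g\<in>U. inv g \<otimes> F n x0 \<in> E (Suc i)"
    then obtain g where "g \<in> U" "inv g \<otimes> F n x0 \<in> E (Suc i)" by blast
    then show "(x0, F n x0) \<in> near U"
      by (intro nearI[of x0 "inv g \<otimes> F n x0"]) (simp_all add: H_x0 G.group_simps)
  qed
  \<comment> \<open>Recurrence supplies a small value at some nearby z only; the dichotomy on Y
    transfers it to \<open>x0\<close> itself.\<close>
  have rigid: "\<exists>r\<ge>1. \<alpha> r \<in> B \<and> (x0, F r x0) \<in> near U"
    if BU: "open B" "\<one>\<^bsub>X\<^esub> \<in> B" "open U" "\<one> \<in> U" for B U
  proof -
    \<comment> \<open>This second gap sharpens W to the given U at \<open>x0\<close>, so recurrence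
      only needs to reach the fixed \<open>U0\<close>.\<close>
    obtain Y1 B1 where Y1: "x0 \<in> Y1" and B1: "open B1" "\<one>\<^bsub>X\<^esub> \<in> B1"
      and gap1: "\<And>y n. y \<in> Y1 \<Longrightarrow> \<alpha> n \<in> B1 \<Longrightarrow> (y, F n y) \<in> near W \<Longrightarrow> (y, F n y) \<in> near U"
      using near_gap[OF W(2) BU(3,4)] by metis
    obtain D where D: "open D" "(x0, \<one>) \<in> D"
      "\<And>b h b' h'. (b, h) \<in> D \<Longrightarrow> (b', h') \<in> D \<Longrightarrow>
        b \<otimes>\<^bsub>X\<^esub> inv\<^bsub>X\<^esub> b' \<in> B \<inter> B0 \<inter> B1 \<and> h \<otimes> inv h' \<in> U0"
      using uniform_division[of "B \<inter> B0 \<inter> B1" U0] BU B0 B1 W by (metis IntI open_Int)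
    obtain V V' where V: "open V" "open V'" "(x0, \<one>) \<in> V \<times> V'" "V \<times> V' \<subseteq> D"
      using D(1,2) by (rule open_prod_elim)
    obtain n z where n: "n \<noteq> 0" "z \<in> V \<inter> Y" "\<alpha> n \<otimes>\<^bsub>X\<^esub> z \<in> V \<inter> Y" "F n z \<in> V'"
      using recurrent[of V' "V \<inter> Y" x0] V Y by blast
    have in_D: "(z, F n z) \<in> D" "(z, \<one>) \<in> D" "(\<alpha> n \<otimes>\<^bsub>X\<^esub> z, \<one>) \<in> D"
      using n V by auto
    \<comment> \<open>The recurrence time may be negative; then the return is read backwards from
      its end point.\<close>
    have "\<exists>r\<ge>1. \<exists>y\<in>Y. \<alpha> r \<in> B \<inter> B0 \<inter> B1 \<and> F r y \<in> U0"
    proof (cases "n > 0")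
      case True
      then show ?thesis
        using n D(3)[OF in_D(3,2)] D(3)[OF in_D(1,2)]
        by (intro exI[of _ n] conjI bexI[of _ z]) (auto simp: X.group_simps)
    next
      case False
      then show ?thesis
        using n D(3)[OF in_D(2,3)] D(3)[OF in_D(2,1)]
        by (intro exI[of _ "- n"] conjI bexI[of _ "\<alpha> n \<otimes>\<^bsub>X\<^esub> z"])
          (auto simp: X.group_simps coc_minus)
    qed
    then obtain r y where r: "r \<ge> 1" "y \<in> Y" "\<alpha> r \<in> B \<inter> B0 \<inter> B1" "F r y \<in> U0" by blast
    have "(y, F r y) \<in> near W"
      using r W by (intro nearI[OF H_one]) auto
    with r Y have "(x0, F r x0) \<in> near W"
      by (intro dichotomy[of r y x0]) auto
    with r Y1 gap1 show ?thesis by auto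
  qed
  \<comment> \<open>A rigidity time r is added to q: then \<open>\<alpha> (q + r)\<close> stays near
    \<open>\<alpha> q\<close>, and the cocycle stays near g modulo \<open>E (Suc i)\<close>.\<close>
  have shift1: "\<exists>q'>q. \<exists>g'. (\<alpha> q', g') \<in> D \<and> inv g' \<otimes> F q' x0 \<in> E (Suc i)"
    if D: "open D" "(\<alpha> q, g) \<in> D" and g: "inv g \<otimes> F q x0 \<in> E (Suc i)" for q g D
  proof -
    define h where "h = inv g \<otimes> F q x0"
    have "open {p. (\<alpha> q \<otimes>\<^bsub>X\<^esub> fst p, F q (fst p \<otimes>\<^bsub>X\<^esub> x0) \<otimes> snd p \<otimes> inv h) \<in> D}"
      by (intro open_Collect_mem D continuous_intros X.continuous_on_mult)
    moreover have "(\<one>\<^bsub>X\<^esub>, \<one>) \<in> \<dots>"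
      using D by (simp add: h_def G.group_simps)
    ultimately obtain B U where BU: "open B" "open U" "(\<one>\<^bsub>X\<^esub>, \<one>) \<in> B \<times> U" "B \<times> U \<subseteq>
        {p. (\<alpha> q \<otimes>\<^bsub>X\<^esub> fst p, F q (fst p \<otimes>\<^bsub>X\<^esub> x0) \<otimes> snd p \<otimes> inv h) \<in> D}"
      by (rule open_prod_elim)
    obtain r where r: "r \<ge> 1" "\<alpha> r \<in> B" "(x0, F r x0) \<in> near U"
      using rigid[of B U] BU by auto
    then obtain u where u: "u \<in> U" "inv u \<otimes> F r x0 \<in> E (Suc i)"
      unfolding near_x0 by blast
    \<comment> \<open>Near \<open>F q x0 \<otimes> inv h\<close>, which equals g; the remaining
      factor of \<open>F (q + r) x0\<close> is h times an element of
      \<open>E (Suc i)\<close>.\<close>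
    let ?g = "F q (\<alpha> r \<otimes>\<^bsub>X\<^esub> x0) \<otimes> u \<otimes> inv h"
    have "(\<alpha> (q + r), ?g) \<in> D"
      using BU r u by (auto simp: rot_add)
    moreover have "inv ?g \<otimes> F (q + r) x0 \<in> E (Suc i)"
      using E_mult[OF g u(2)] by (simp add: coc_add h_def G.group_simps)
    ultimately show ?thesis
      using r by (intro exI[of _ "q + r"]) auto
  qed
  have shift: "\<exists>q'\<ge>m. \<exists>g'. (\<alpha> q', g') \<in> D \<and> inv g' \<otimes> F q' x0 \<in> E (Suc i)"
    if D: "open D" "(\<alpha> q, g) \<in> D" and g: "inv g \<otimes> F q x0 \<in> E (Suc i)" for q g D m
  proof -
    have "\<exists>q'\<ge>q + int k. \<exists>g'. (\<alpha> q', g') \<in> D \<and> inv g' \<otimes> F q' x0 \<in> E (Suc i)" for k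
    proof (induction k)
      case (Suc k)
      then obtain q' g' where q': "q' \<ge> q + int k" "(\<alpha> q', g') \<in> D" "inv g' \<otimes> F q' x0 \<in> E (Suc i)"
        by blast
      obtain q'' where "q'' > q'" "\<exists>g'. (\<alpha> q'', g') \<in> D \<and> inv g' \<otimes> F q'' x0 \<in> E (Suc i)"
        using shift1[OF D(1) q'(2,3)] by blast
      with q'(1) show ?case by (intro exI[of _ q'']) auto
    qed (use that in auto)
    from this[of "nat (m - q)"] obtain q' where
      "q' \<ge> q + int (nat (m - q))" "\<exists>g'. (\<alpha> q', g') \<in> D \<and> inv g' \<otimes> F q' x0 \<in> E (Suc i)"
      by blast
    then show ?thesis
      by (intro exI[of _ q']) (auto split: if_splits)
  qed
  \<comment> \<open>As in the proof that a non-discrete monothetic locally compact group is compact: \<open>S\<close> is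
    unbounded above and closed under subtracting a suitable one of finitely many positive steps,
    hence has bounded gaps.\<close>
  define S where "S = {k. \<alpha> k \<otimes>\<^bsub>X\<^esub> x0 \<in> Y \<and> (x0, F k x0) \<in> near W}"
  have open_YX: "open {b. b \<otimes>\<^bsub>X\<^esub> x0 \<in> Y}"
    by (rule X.open_translate_right[OF Y(1)])
  \<comment> \<open>\<open>B0\<close> permits the dichotomy at time k - q, and the second set keeps
    its displacement of \<open>x0\<close> inside Y.\<close>
  define B2 where "B2 = B0 \<inter> {b. b \<otimes>\<^bsub>X\<^esub> x0 \<in> Y}"
  have B2: "open B2" "\<one>\<^bsub>X\<^esub> \<in> B2"
    using B0 Y open_YX by (auto simp: B2_def)
  have "\<exists>D. open D \<and> p \<in> D \<and> (\<forall>b h b' h'. (b, h) \<in> D \<longrightarrow> (b', h') \<in> D \<longrightarrow>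
      b \<otimes>\<^bsub>X\<^esub> inv\<^bsub>X\<^esub> b' \<in> B2 \<and> h \<otimes> inv h' \<in> U0)" for p
    by (rule uniform_division[OF B2 W(1,3), of p]) blast
  then obtain D where "\<forall>p. open (D p) \<and> p \<in> D p \<and> (\<forall>b h b' h'. (b, h) \<in> D p \<longrightarrow>
      (b', h') \<in> D p \<longrightarrow> b \<otimes>\<^bsub>X\<^esub> inv\<^bsub>X\<^esub> b' \<in> B2 \<and> h \<otimes> inv h' \<in> U0)"
    by metis
  then have D: "\<And>p. open (D p)" "\<And>p. p \<in> D p"
    "\<And>p b h b' h'. (b, h) \<in> D p \<Longrightarrow> (b', h') \<in> D p \<Longrightarrow>
        b \<otimes>\<^bsub>X\<^esub> inv\<^bsub>X\<^esub> b' \<in> B2 \<and> h \<otimes> inv h' \<in> U0"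
    by blast+
  obtain C where C: "finite C" "UNIV \<times> W \<subseteq> (\<Union>p\<in>C. D p)"
  proof (rule compactE_image[OF compact_Times[OF compact_X W(2)], of UNIV D])
    show "UNIV \<times> W \<subseteq> \<Union> (range D)" using D(2) by blast
  qed (use D(1) in auto)
  \<comment> \<open>One positive step q serves all k in \<open>S\<close> that have a representative
    in the same \<open>D p\<close>. If there is none, any q works.\<close>
  have "\<exists>q\<ge>1. \<forall>k\<in>S. \<forall>g. inv g \<otimes> F k x0 \<in> E (Suc i) \<and> (\<alpha> k, g) \<in> D p \<longrightarrow> k - q \<in> S" for p
  proof (cases "\<exists>k\<in>S. \<exists>g. inv g \<otimes> F k x0 \<in> E (Suc i) \<and> (\<alpha> k, g) \<in> D p")
    case True
    then obtain k0 g0 where "k0 \<in> S" "inv g0 \<otimes> F k0 x0 \<in> E (Suc i)" "(\<alpha> k0, g0) \<in> D p" by blast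
    \<comment> \<open>The sample time k0 may be negative; \<open>shift\<close> replaces it by a
      positive time in the same small set.\<close>
    then obtain q g' where q: "q \<ge> 1" "(\<alpha> q, g') \<in> D p \<inter> ({b. b \<otimes>\<^bsub>X\<^esub> x0 \<in> Y} \<times> UNIV)"
      "inv g' \<otimes> F q x0 \<in> E (Suc i)"
      using shift[of "D p \<inter> ({b. b \<otimes>\<^bsub>X\<^esub> x0 \<in> Y} \<times> UNIV)" k0 g0 1] D(1) open_YX
      by (auto simp: S_def open_Times open_Int)
    let ?y = "\<alpha> q \<otimes>\<^bsub>X\<^esub> x0"
    have "(?y, F q x0) \<in> M i"
      using orbI[OF A_one, of q x0 i] by simp
    from M_mult_E[OF this, of "inv (inv g' \<otimes> F q x0)"] have g': "(?y, g') \<in> M i"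
      using subsetD[OF E_Suc_subset E_inv[OF q(3)]] by (simp add: G.group_simps)
    have "k - q \<in> S" if k: "k \<in> S" "inv g \<otimes> F k x0 \<in> E (Suc i)" "(\<alpha> k, g) \<in> D p" for k g
    proof -
      have diff: "\<alpha> k \<otimes>\<^bsub>X\<^esub> inv\<^bsub>X\<^esub> \<alpha> q \<in> B2" "g \<otimes> inv g' \<in> U0"
        using D(3)[OF k(3)] q(2) by auto
      then have \<alpha>: "\<alpha> (k - q) \<in> B2"
        using rot_add[of k "- q"] by simp
      have "F (k - q) ?y \<otimes> F q x0 = F k x0"
        using coc_add[of "k - q" q x0] by simp
      then have F: "F (k - q) ?y = F k x0 \<otimes> inv F q x0"
        using G.inv_solve_right by simp
      \<comment> \<open>This element lies in \<open>H\<close> over \<open>?y\<close> since g' lies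
        in that fibre of \<open>M i\<close>; \<open>F (k - q) ?y\<close> is the small quotient
        \<open>g \<otimes> inv g'\<close> times it.\<close>
      have "(?y, g' \<otimes> (inv g \<otimes> F k x0) \<otimes> inv (inv g' \<otimes> F q x0) \<otimes> inv g') \<in> H"
        using E_mult[OF k(2) E_inv[OF q(3)]] by (simp add: H_eq[OF g'] G.group_simps)
      from nearI[OF this, of "F (k - q) ?y" W] have "(?y, F (k - q) ?y) \<in> near W"
        using subsetD[OF W(4) diff(2)] by (simp add: F G.group_simps)
      then show ?thesis
        using dichotomy[of "k - q" ?y x0] \<alpha> q(2) Y(3) by (simp add: S_def B2_def)
    qed
    with q(1) show ?thesis by blast
  qed auto
  then obtain q where q: "\<And>p. q p \<ge> 1"
    "\<And>p k g. k \<in> S \<Longrightarrow> inv g \<otimes> F k x0 \<in> E (Suc i) \<Longrightarrow> (\<alpha> k, g) \<in> D p \<Longrightarrow> k - q p \<in> S"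
    by metis
  obtain N where N: "\<And>p. p \<in> C \<Longrightarrow> q p \<le> N"
    using C(1) by (metis bdd_above.E bdd_above_finite finite_imageI imageI)
  have descend: "\<exists>j\<ge>1. j \<le> N \<and> k - j \<in> S" if k: "k \<in> S" for k
  proof -
    obtain g where g: "g \<in> W" "inv g \<otimes> F k x0 \<in> E (Suc i)"
      using k near_x0 by (auto simp: S_def)
    then obtain p where "p \<in> C" "(\<alpha> k, g) \<in> D p"
      using subsetD[OF C(2), of "(\<alpha> k, g)"] by blast
    with k g q N show ?thesis by blast
  qed
  \<comment> \<open>Start at time 0, where the cocycle is trivial, and apply
    \<open>shift\<close>.\<close>
  have above: "\<exists>k\<in>S. k \<ge> n" for n
  proof -
    have "\<exists>q'\<ge>n. \<exists>g'. (\<alpha> q', g') \<in> {b. b \<otimes>\<^bsub>X\<^esub> x0 \<in> Y} \<times> U0 \<and> inv g' \<otimes> F q' x0 \<in> E (Suc i)"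
      by (rule shift[of _ 0 \<one>]) (use open_YX W Y E_one in \<open>auto simp: open_Times\<close>)
    then obtain k g where k: "k \<ge> n" "\<alpha> k \<otimes>\<^bsub>X\<^esub> x0 \<in> Y" "g \<in> U0" "inv g \<otimes> F k x0 \<in> E (Suc i)"
      by auto
    with W(4) show ?thesis
      by (intro bexI[of _ k]) (auto simp: S_def near_x0)
  qed
  \<comment> \<open>Descend from a time in \<open>S\<close> above n in steps of at most
    \<open>N\<close>; the last time not below n lies in the window.\<close>
  have window: "\<exists>r\<in>S. n \<le> r \<and> r < n + N" for n
  proof -
    have "\<exists>r\<in>S. n \<le> r \<and> r < n + N" if "k \<in> S" "k = n + int m" for k m
      using that
    proof (induction m arbitrary: k rule: less_induct)
      case (less m)
      obtain j where j: "j \<ge> 1" "j \<le> N" "k - j \<in> S"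
        using descend[OF less.prems(1)] by blast
      show ?case
      proof (cases "k - j \<ge> n")
        case True
        then show ?thesis
          using less.IH[of "nat (k - j - n)" "k - j"] less.prems j by auto
      next
        case False
        then show ?thesis
          using less.prems j by (intro bexI[of _ k]) auto
      qed
    qed
    with above[of n] show ?thesis
      using zle_iff_zadd by blast
  qed
  \<comment> \<open>The time r in the window exceeds n by some j below \<open>N\<close>, so
    \<open>F n x0\<close> is \<open>F (- j)\<close> at the point reached at time r, times
    \<open>F r x0\<close>.\<close>
  let ?K = "\<Union>j\<in>{0..<N}. (\<lambda>p. F (- j) (fst p) \<otimes> snd p) ` (UNIV \<times> W)"
  have "compact ?K"
    by (intro compact_UN compact_continuous_image compact_Times compact_X W finite_atLeastLessThan_int
        continuous_intros)
  moreover have "\<exists>k\<in>?K. inv k \<otimes> F n x0 \<in> E (Suc i)" for n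
  proof -
    obtain r where r: "r \<in> S" "n \<le> r" "r < n + N"
      using window by blast
    then obtain w where w: "w \<in> W" "inv w \<otimes> F r x0 \<in> E (Suc i)"
      using near_x0 by (auto simp: S_def)
    let ?k = "F (- (r - n)) (\<alpha> r \<otimes>\<^bsub>X\<^esub> x0) \<otimes> w"
    have "F n x0 = F (- (r - n)) (\<alpha> r \<otimes>\<^bsub>X\<^esub> x0) \<otimes> F r x0"
      using coc_add[of "- (r - n)" r x0] by simp
    then have "inv ?k \<otimes> F n x0 \<in> E (Suc i)"
      using w(2) by (simp add: G.group_simps)
    moreover have "?k \<in> ?K"
      using r w(1) by (intro UN_I[of "r - n"] image_eqI[of _ _ "(\<alpha> r \<otimes>\<^bsub>X\<^esub> x0, w)"]) auto
    ultimately show ?thesis by blast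
  qed
  ultimately show ?thesis
    unfolding tight_def by blast
qed

end

text \<open>Both properties are carried together: at level i they yield tightness at
  \<open>Suc i\<close>, which in turn yields distality there.\<close>

lemma (in generic_orbit) tight_distal: "\<exists>K. tight i K \<and> distal i"
proof (induction i)
  case 0
  then show ?case
    using tight_0 distal_0 by blast
next
  case (Suc i)
  then obtain K where "tight i K" "distal i" by blast
  then interpret tight_level X G \<alpha> F A x0 i K
    by unfold_locales
  show ?case
    using tight_Suc distal_Suc[OF _ dist] by blast
qed

subsection \<open>Existence of generic points\<close>

text \<open>The boundary of an open set is nowhere dense. By Baire some x avoids the boundaries of
  countably many sets describing approximate transitions, so what happens arbitrarily near x happens
  at x.\<close>

lemma (in rotation_cocycle) generic_point_exists:
  fixes A :: "nat \<Rightarrow> 'g set" and \<B> :: "'x set set" and \<V> :: "'g set set"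
  assumes baire: "\<And>\<F> :: 'x set set. countable \<F> \<Longrightarrow>
      (\<And>S. S \<in> \<F> \<Longrightarrow> closed S \<and> interior S = {}) \<Longrightarrow> \<Union>\<F> \<noteq> UNIV"
    and B: "countable \<B>" "\<And>B. B \<in> \<B> \<Longrightarrow> open B"
      "\<And>U. open U \<Longrightarrow> \<one>\<^bsub>X\<^esub> \<in> U \<Longrightarrow> \<exists>B\<in>\<B>. \<one>\<^bsub>X\<^esub> \<in> B \<and> B \<subseteq> U"
    and V: "countable \<V>" "topological_basis \<V>"
  obtains x where
    "\<And>i g. (x, \<one>\<^bsub>X\<^esub>, g) \<in> closure (ret (A i)) \<Longrightarrow> (x, g) \<in> closure (orb x (A i))"
proof -
  \<comment> \<open>Base points with a transition whose displacement lies in B and whose value lies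
    in V modulo \<open>A i\<close>; open since each \<open>F n\<close> is continuous.\<close>
  define Q where "Q = (\<lambda>(i, B, V). {x. \<exists>n. \<exists>s\<in>A i. \<alpha> n \<in> B \<and> F n x \<otimes> s \<in> V})"
  have open_Q: "open (Q (i, B, V))" if "V \<in> \<V>" for i B V
  proof -
    have "Q (i, B, V) = (\<Union>n\<in>{n. \<alpha> n \<in> B}. \<Union>s\<in>A i. {x. F n x \<otimes> s \<in> V})"
      by (auto simp: Q_def)
    moreover have "open V"
      using V(2) that by (rule topological_basis_open)
    ultimately show ?thesis
      by (auto intro!: open_Collect_mem continuous_intros)
  qed
  let ?I = "(UNIV :: nat set) \<times> \<B> \<times> \<V>"
  have "\<Union>((\<lambda>p. closure (Q p) - Q p) ` ?I) \<noteq> UNIV"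
  proof (rule baire)
    show "countable ((\<lambda>p. closure (Q p) - Q p) ` ?I)"
      using B V by auto
    fix S assume "S \<in> (\<lambda>p. closure (Q p) - Q p) ` ?I"
    then obtain p where S: "S = closure (Q p) - Q p" "open (Q p)"
      using open_Q by auto
    have "interior S \<inter> Q p = {}"
      using interior_subset[of S] S by blast
    then have "interior S \<inter> closure (Q p) = {}"
      by (simp add: open_Int_closure_eq_empty)
    then have "interior S = {}"
      using interior_subset[of S] S by blast
    then show "closed S \<and> interior S = {}"
      using S by (simp add: closed_Diff)
  qed
  then obtain x where x: "\<And>i B V. B \<in> \<B> \<Longrightarrow> V \<in> \<V> \<Longrightarrow> x \<in> closure (Q (i, B, V)) \<Longrightarrow> x \<in> Q (i, B, V)"
    by blast
  show thesis
  proof (rule that, rule ccontr)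
    fix i g assume g: "(x, \<one>\<^bsub>X\<^esub>, g) \<in> closure (ret (A i))" and "(x, g) \<notin> closure (orb x (A i))"
    then obtain Y V where YV: "open Y" "open V" "(x, g) \<in> Y \<times> V" "Y \<times> V \<subseteq> - closure (orb x (A i))"
      using open_prod_elim[of "- closure (orb x (A i))" "(x, g)"] by (metis ComplI closed_closure open_Compl)
    obtain V' where V': "V' \<in> \<V>" "g \<in> V'" "V' \<subseteq> V"
      using topological_basisE[OF V(2) YV(2), of g] YV(3) by auto
    obtain B' where B': "B' \<in> \<B>" "\<one>\<^bsub>X\<^esub> \<in> B'" "B' \<subseteq> {b. b \<otimes>\<^bsub>X\<^esub> x \<in> Y}"
      using B(3)[OF X.open_translate_right[OF YV(1)], of x] YV(3) by auto
    \<comment> \<open>Otherwise a neighbourhood of (x, 1, g) would contain no transition at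
      all.\<close>
    have "x \<in> closure (Q (i, B', V'))"
    proof (rule ccontr)
      let ?D = "(- closure (Q (i, B', V'))) \<times> B' \<times> V'"
      assume "x \<notin> closure (Q (i, B', V'))"
      then have "(x, \<one>\<^bsub>X\<^esub>, g) \<in> ?D \<inter> closure (ret (A i))"
        using g B' V' by auto
      moreover have "open ?D"
        using B(2)[OF B'(1)] topological_basis_open[OF V(2) V'(1)] by (auto intro!: open_Times)
      ultimately have "?D \<inter> ret (A i) \<noteq> {}"
        using open_Int_closure_eq_empty by blast
      then show False
        using closure_subset[of "Q (i, B', V')"] by (auto simp: ret_def Q_def)
    qed
    then have "x \<in> Q (i, B', V')"
      using x B' V' by blast
    then obtain n s where "s \<in> A i" "\<alpha> n \<in> B'" "F n x \<otimes> s \<in> V'"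
      by (auto simp: Q_def)
    then have "(\<alpha> n \<otimes>\<^bsub>X\<^esub> x, F n x \<otimes> s) \<in> Y \<times> V" "(\<alpha> n \<otimes>\<^bsub>X\<^esub> x, F n x \<otimes> s) \<in> closure (orb x (A i))"
      using B' V' by (auto intro: orbI)
    with YV(4) show False by blast
  qed
qed

subsection \<open>The skew product and the lower central series\<close>

lemma iter_int_0 [simp]: "iter_int T 0 x = x"
  by (simp add: iter_int_def)

lemma iter_int_Suc:
  assumes "bij T"
  shows "iter_int T (n + 1) x = T (iter_int T n x)"
proof (cases "n \<ge> 0")
  case False
  define k where "k = nat (- n - 1)"
  have k: "nat (- n) = Suc k" "nat (- (n + 1)) = k"
    using False by (simp_all add: k_def)
  have "iter_int T n x = inv_into UNIV T ((inv_into UNIV T ^^ k) x)"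
    using False by (simp add: iter_int_def k)
  moreover have "iter_int T (n + 1) x = (inv_into UNIV T ^^ k) x"
    using False k(2) by (cases "n = -1") (simp_all add: iter_int_def)
  ultimately show ?thesis
    using assms by (simp add: bij_is_surj surj_f_inv_f)
qed (simp add: iter_int_def nat_add_distrib)

text \<open>A two-sided orbit is determined by its value at 0; injectivity of T gives the backward
  step. Later identifications of iterates all go through this.\<close>

lemma iter_int_unique:
  assumes T: "bij T" and 0: "P 0 = x" and Suc: "\<And>n. P (n + 1) = T (P n)"
  shows "iter_int T n x = P n"
proof (induction n rule: int_induct[where k = 0])
  case (step2 n)
  have "T (iter_int T (n - 1) x) = T (P (n - 1))"
    using iter_int_Suc[OF T, of "n - 1" x] Suc[of "n - 1"] step2 by simp
  then show ?case
    using T by (simp add: bij_def inj_eq)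
qed (simp_all add: 0 Suc iter_int_Suc[OF T])

lemma iter_int_add:
  assumes "bij T"
  shows "iter_int T (m + n) x = iter_int T m (iter_int T n x)"
proof (rule iter_int_unique[OF assms, where P = "\<lambda>m. iter_int T (m + n) x", symmetric])
  fix m
  show "iter_int T (m + 1 + n) x = T (iter_int T (m + n) x)"
    using iter_int_Suc[OF assms, of "m + n" x] by (simp add: ac_simps)
qed simp

lemma iter_int_rotation:
  assumes "topgroup X" "bij T" "\<And>x. T x = a \<otimes>\<^bsub>X\<^esub> x"
  shows "iter_int T n x = iter_int T n \<one>\<^bsub>X\<^esub> \<otimes>\<^bsub>X\<^esub> x"
proof -
  interpret topgroup X by fact
  show ?thesis
  proof (rule iter_int_unique[OF assms(2)])
    fix n
    have "iter_int T (n + 1) \<one>\<^bsub>X\<^esub> = a \<otimes>\<^bsub>X\<^esub> iter_int T n \<one>\<^bsub>X\<^esub>"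
      using iter_int_Suc[OF assms(2)] assms(3) by metis
    then show "iter_int T (n + 1) \<one>\<^bsub>X\<^esub> \<otimes>\<^bsub>X\<^esub> x = T (iter_int T n \<one>\<^bsub>X\<^esub> \<otimes>\<^bsub>X\<^esub> x)"
      by (simp only: assms(3)) (simp add: m_assoc)
  qed simp
qed

context topgroup
begin

section \<open>The cocycle as the group coordinate of skew product iterates\<close>

lemma cocycle_nat_Suc': "cocycle_nat G f T (Suc n) x = cocycle_nat G f T n (T x) \<otimes> f x"
  by (induction n) (simp_all add: m_assoc funpow_swap1)

text \<open>For negative n the inverse of the product from \<open>iter_int T n x\<close> back to x
  loses its first factor, which is why that product is expanded at the right end. Time -1 steps into
  the nonnegative branch and is treated apart.\<close>

lemma cocycle_Suc:
  assumes "bij T"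
  shows "cocycle G f T (n + 1) x = f (iter_int T n x) \<otimes> cocycle G f T n x"
proof (cases "n \<ge> 0")
  case True
  then show ?thesis
    by (simp add: cocycle_def nat_add_distrib iter_int_def)
next
  case False
  define k where "k = nat (- n - 1)"
  have k: "nat (- n) = Suc k" "nat (- (n + 1)) = k"
    using False by (simp_all add: k_def)
  define z where "z = iter_int T n x"
  have "iter_int T (n + 1) x = T z"
    unfolding z_def by (rule iter_int_Suc[OF assms])
  then have "cocycle G f T (n + 1) x = inv (cocycle_nat G f T k (T z))"
    using False k(2) by (cases "n = -1") (simp_all add: cocycle_def)
  moreover have "cocycle G f T n x = inv (cocycle_nat G f T (Suc k) z)"
    using False by (simp add: cocycle_def z_def k del: cocycle_nat.simps)
  ultimately show ?thesis
    by (simp add: cocycle_nat_Suc' inv_mult_group z_def del: cocycle_nat.simps(2))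
qed

lemma bij_skew_product:
  assumes "bij T"
  shows "bij (skew_product G f T)"
proof (rule o_bij)
  show "(\<lambda>(y, h). (inv_into UNIV T y, inv (f (inv_into UNIV T y)) \<otimes> h)) \<circ> skew_product G f T = id"
    using assms by (auto simp: skew_product_def bij_def)
  show "skew_product G f T \<circ> (\<lambda>(y, h). (inv_into UNIV T y, inv (f (inv_into UNIV T y)) \<otimes> h)) = id"
    using assms by (auto simp: skew_product_def bij_def surj_f_inv_f)
qed

lemma iter_int_skew_product:
  assumes "bij T"
  shows "iter_int (skew_product G f T) n (x, g) = (iter_int T n x, cocycle G f T n x \<otimes> g)"
  by (rule iter_int_unique[OF bij_skew_product[OF assms]])
    (simp_all add: skew_product_def iter_int_Suc[OF assms] cocycle_Suc[OF assms] m_assoc,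
      simp add: cocycle_def)

text \<open>Group coordinate of the additivity of skew product iterates, which avoids a case split
  on signs.\<close>

lemma cocycle_add:
  assumes "bij T"
  shows "cocycle G f T (m + n) x = cocycle G f T m (iter_int T n x) \<otimes> cocycle G f T n x"
  using iter_int_add[OF bij_skew_product[OF assms], of f m n "(x, \<one>)"]
  by (simp add: iter_int_skew_product[OF assms])

section \<open>Normality and descent of the lower central series\<close>

lemma normal_lower_central: "lower_central G k \<lhd> G"
proof (induction k)
  case 0
  then show ?case
    using normal_invI[OF subgroup_self] by simp
next
  case (Suc k)
  then interpret N: normal "lower_central G k" G .
  show ?case
    unfolding lower_central.simps
  proof (rule normal_generateI)
    fix h g
    assume "h \<in> {x \<otimes> y \<otimes> inv x \<otimes> inv y |x y. x \<in> lower_central G k \<and> y \<in> carrier G}"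
    then obtain x y where h: "h = x \<otimes> y \<otimes> inv x \<otimes> inv y" "x \<in> lower_central G k" by blast
    let ?x = "g \<otimes> x \<otimes> inv g" and ?y = "g \<otimes> y \<otimes> inv g"
    have "g \<otimes> h \<otimes> inv g = ?x \<otimes> ?y \<otimes> inv ?x \<otimes> inv ?y"
      by (simp add: h group_simps)
    moreover have "?x \<in> lower_central G k"
      using h N.inv_op_closed2 by simp
    ultimately show "g \<otimes> h \<otimes> inv g
        \<in> {x \<otimes> y \<otimes> inv x \<otimes> inv y |x y. x \<in> lower_central G k \<and> y \<in> carrier G}"
      by auto
  qed simp
qed

lemma lower_central_commutator:
  "a \<in> lower_central G k \<Longrightarrow> a \<otimes> y \<otimes> inv a \<otimes> inv y \<in> lower_central G (Suc k)"
  by (auto intro!: generate.incl)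

lemma lower_central_Suc_subset: "lower_central G (Suc k) \<subseteq> lower_central G k"
proof -
  interpret N: normal "lower_central G k" G by (rule normal_lower_central)
  have "x \<otimes> (y \<otimes> inv x \<otimes> inv y) \<in> lower_central G k" if "x \<in> lower_central G k" for x y
    using that N.inv_op_closed2[of y "inv x"] N.m_closed[of x "y \<otimes> inv x \<otimes> inv y"]
    by (simp add: m_assoc)
  then show ?thesis
    unfolding lower_central.simps
    by (intro generate_subgroup_incl N.subgroup_axioms) (auto simp: m_assoc)
qed

end

theorem theorem4p6:
  fixes X :: "('x::topological_space) monoid"
    and G :: "('g::{t2_space, second_countable_topology}) monoid"
    and T :: "'x \<Rightarrow> 'x"
    and f :: "'x \<Rightarrow> 'g"
  assumes "topological_group X"
    and "compact_space (euclidean :: 'x topology)"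
    and "metrizable_space (euclidean :: 'x topology)"
    and "locally_connected_space (euclidean :: 'x topology)"
    and "rotation X T"
    and "minimal_homeo T"
    and "topological_group G"
    and "nilpotent_group G"
    and "locally_compact_space (euclidean :: 'g topology)"
    and "continuous_on UNIV f"
    and "topologically_recurrent G f T"
  shows "regular_cocycle G f T"
proof -
  interpret X: topgroup X using assms(1) by (simp add: topgroup_iff)
  interpret G: topgroup G using assms(7) by (simp add: topgroup_iff)
  obtain a where a: "\<And>x. T x = a \<otimes>\<^bsub>X\<^esub> x"
    using assms(5) by (auto simp: rotation_def)
  have T: "bij T"
    using assms(6)
    by (intro o_bij[of "inv_into UNIV T"]) (auto simp: minimal_homeo_def homeomorphism_def)
  define \<alpha> where "\<alpha> n = iter_int T n \<one>\<^bsub>X\<^esub>" for n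
  define F where "F = cocycle G f T"
  have iter: "iter_int T n x = \<alpha> n \<otimes>\<^bsub>X\<^esub> x" for n x
    unfolding \<alpha>_def by (rule iter_int_rotation[OF X.topgroup_axioms T a])
  have cont_nat: "continuous_on UNIV (cocycle_nat G f T n)" for n
  proof (induction n)
    case (Suc n)
    have "(T ^^ n) x = \<alpha> (int n) \<otimes>\<^bsub>X\<^esub> x" for x
      using iter[of "int n" x] by (simp add: iter_int_def)
    then have "cocycle_nat G f T (Suc n)
        = (\<lambda>x. f (\<alpha> (int n) \<otimes>\<^bsub>X\<^esub> x) \<otimes>\<^bsub>G\<^esub> cocycle_nat G f T n x)"
      by auto
    moreover have "continuous_on UNIV \<dots>"
      by (intro G.continuous_on_mult Suc continuous_on_compose2[OF assms(10)]
          X.continuous_on_mult continuous_intros subset_UNIV)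
    ultimately show ?case by simp
  qed simp
  interpret rotation_cocycle X G \<alpha> F
  proof
    fix m n y
    show "\<alpha> (m + n) = \<alpha> m \<otimes>\<^bsub>X\<^esub> \<alpha> n"
      using iter_int_add[OF T, of m n "\<one>\<^bsub>X\<^esub>"] by (simp add: iter)
    show "F (m + n) y = F m (\<alpha> n \<otimes>\<^bsub>X\<^esub> y) \<otimes>\<^bsub>G\<^esub> F n y"
      unfolding F_def using G.cocycle_add[OF T] by (simp add: iter)
    show "continuous_on UNIV (F n)"
    proof (cases "n \<ge> 0")
      case True
      then have "F n = cocycle_nat G f T (nat n)"
        by (auto simp: F_def cocycle_def)
      then show ?thesis
        by (simp add: cont_nat)
    next
      case False
      then have "F n = (\<lambda>x. inv\<^bsub>G\<^esub> cocycle_nat G f T (nat (- n)) (\<alpha> n \<otimes>\<^bsub>X\<^esub> x))"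
        by (auto simp: F_def cocycle_def iter)
      moreover have "continuous_on UNIV \<dots>"
        by (intro G.continuous_on_minv continuous_on_compose2[OF cont_nat]
            X.continuous_on_mult continuous_intros subset_UNIV)
      ultimately show ?thesis by simp
    qed
    show "closure (range (\<lambda>n. \<alpha> n \<otimes>\<^bsub>X\<^esub> y)) = UNIV"
      using assms(6) by (simp add: minimal_homeo_def iter full_SetCompr_eq)
    show "compact (UNIV :: 'x set)"
      using assms(2) by (simp add: compact_space_def)
    show "\<exists>U. open U \<and> connected U \<and> y \<in> U \<and> U \<subseteq> V" if "open V" "y \<in> V" for V
      using assms(4) that by (auto simp: locally_connected_space simp flip: open_openin)
    show "\<exists>U W. open U \<and> compact W \<and> \<one>\<^bsub>G\<^esub> \<in> U \<and> U \<subseteq> W"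
      using assms(9) by (simp add: locally_compact_space_def flip: open_openin)
    show "\<exists>n z. n \<noteq> 0 \<and> z \<in> V \<and> \<alpha> n \<otimes>\<^bsub>X\<^esub> z \<in> V \<and> F n z \<in> U"
      if "open U" "\<one>\<^bsub>G\<^esub> \<in> U" "open V" "y \<in> V" for U V
      using assms(11) that unfolding topologically_recurrent_def iter F_def by blast
  qed
  obtain \<B> where \<B>: "countable \<B>" "\<And>B. B \<in> \<B> \<Longrightarrow> open B"
    "\<And>U. open U \<Longrightarrow> \<one>\<^bsub>X\<^esub> \<in> U \<Longrightarrow> \<exists>B\<in>\<B>. \<one>\<^bsub>X\<^esub> \<in> B \<and> B \<subseteq> U"
  proof -
    have "\<exists>\<B>. countable \<B> \<and> (\<forall>B\<in>\<B>. open B) \<and>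
        (\<forall>U. open U \<and> \<one>\<^bsub>X\<^esub> \<in> U \<longrightarrow> (\<exists>B\<in>\<B>. \<one>\<^bsub>X\<^esub> \<in> B \<and> B \<subseteq> U))"
      using metrizable_imp_first_countable[OF assms(3)]
      by (simp add: first_countable_def flip: open_openin)
    then show thesis
      using that by (elim exE conjE) (simp add: Ball_def)
  qed
  obtain \<V> :: "'g set set" where \<V>: "countable \<V>" "topological_basis \<V>"
    using ex_countable_basis by blast
  have "\<Union>\<F> \<noteq> UNIV"
    if "countable \<F>" "\<And>S. S \<in> \<F> \<Longrightarrow> closed S \<and> interior S = {}" for \<F> :: "'x set set"
  proof -
    \<comment> \<open>Compact metrizable spaces are regular and locally compact, so the Baire
      theorem applies.\<close>
    have "euclidean interior_of \<Union>\<F> = {}"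
      using that assms(2,3) by (intro Baire_category_alt)
        (auto intro: metrizable_imp_regular_space compact_imp_locally_compact_space)
    then show ?thesis by auto
  qed
  then obtain x0 where x0: "\<And>i g. (x0, \<one>\<^bsub>X\<^esub>, g) \<in> closure (ret (lower_central G i)) \<Longrightarrow>
      (x0, g) \<in> closure (orb x0 (lower_central G i))"
    using generic_point_exists[OF _ \<B> \<V>, of "lower_central G"] by blast
  interpret generic_orbit X G \<alpha> F "lower_central G" x0
    by (intro generic_orbit.intro generic_orbit_axioms.intro rotation_cocycle_axioms
        G.normal_lower_central G.lower_central_commutator G.lower_central_Suc_subset x0) simp_all
  obtain c where c: "lower_central G c = {\<one>\<^bsub>G\<^esub>}"
    using assms(8) by (auto simp: nilpotent_group_def)
  obtain K where K: "tight c K"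
    using tight_distal by blast
  have skew: "iter_int (skew_product G f T) n (x, \<one>\<^bsub>G\<^esub>) = (\<alpha> n \<otimes>\<^bsub>X\<^esub> x, F n x)" for n x
    by (simp add: G.iter_int_skew_product[OF T] iter F_def)
  \<comment> \<open>At the last level of the series nothing is divided out, so \<open>M c\<close> is
    the true orbit closure of (\<open>x0\<close>, 1), and \<open>M_fibre\<close> gives the
    surjective projection.\<close>
  have "orb x0 {\<one>\<^bsub>G\<^esub>} = {iter_int (skew_product G f T) n (x0, \<one>\<^bsub>G\<^esub>) |n. True}"
    by (auto simp: orb_def skew)
  then have "fst ` closure {iter_int (skew_product G f T) n (x0, \<one>\<^bsub>G\<^esub>) |n. True} = UNIV"
    using M_fibre[OF K] by (force simp: c)
  then show ?thesis
    unfolding regular_cocycle_def by blast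
qed

end
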